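(* For any $n$ and any $d>1$: (a) there is a system $F$ of $n+1$ tropical polynomials in $n+1$ variables over the semiring $\mathbb{R}_\infty$, of (maximal) degree $d$, such that $F$ has no root in $\mathbb{R}_\infty^{n+1}$ but the Macaulay tropical non-homogeneous linear system $M_N\odot(0,\vec y)$ of $F$ with $N=d^{\,n-1}-1$ has a solution over $\mathbb{R}_\infty$; (b) there is a system $F$ of $n+1$ min-plus polynomials in $n+1$ variables over the semiring $\mathbb{R}_\infty$, of (maximal) degree $d$, such that $F$ has no root in $\mathbb{R}_\infty^{n+1}$ but the Macaulay min-plus non-homogeneous linear system $\mathit{Ml}_N\odot(0,\vec y)=\mathit{Mr}_N\odot(0,\vec y)$ of $F$ with $N=d^{\,n-1}-1$ has a solution over $\mathbb{R}_\infty$.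
   Context: $\mathbb{R}_\infty=\mathbb{R}\cup\{+\infty\}$ with $x\oplus y=\min\{x,y\}$, $x\odot y=x+y$. In variables $\vec x=(x_1,\dots,x_s)$, a tropical monomial is $m(\vec x)=c\odot \vec x^{I}$ with $c\in\mathbb{R}_\infty$, $I\in\mathbb{Z}_{\ge0}^s$ and $\vec x^{I}=i_1x_1+\dots+i_sx_s$ in classical notation (with $0\cdot\infty=0$); its degree is $|I|=i_1+\dots+i_s$. A tropical polynomial is a finite tropical sum $f=\min_i m_i$ of monomials with pairwise distinct exponent vectors; its degree is the maximal degree of its monomials. A point $\vec a\in\mathbb{R}_\infty^s$ is a root of $f$ if $\min_i m_i(\vec a)$ is attained on at least two different monomials or is equal to $\infty$. A min-plus polynomial is a pair $(f,g)$ of tropical polynomials, of degree $\max(\deg f,\deg g)$; $\vec a$ is a root of it if $f(\vec a)=g(\vec a)$. A root of a system is a common root of all its members. Macaulay matrices: for a tropical system $\{f_1,\dots,f_k\}$ in $s$ variables the infinite matrix $M$ has columns indexed by $I\in\mathbb{Z}_{\ge0}^s$ and rows indexed by pairs $(j,J)$, $1\le j\le k$, $J\in\mathbb{Z}_{\ge0}^s$; the entry in row $(j,J)$ and column $I$ is the coefficient of $\vec x^I$ in $\vec x^J\odot f_j$ ($\infty$ if absent). $M_N$ is the submatrix consisting of the columns $I$ with $|I|\le N$ and of those rows all of whose finite entries lie in these columns. For a min-plus system $\{(f_j,g_j)\}$ the matrices $\mathit{Ml}$, $\mathit{Mr}$ are defined in the same way from the $f_j$ and from the $g_j$ respectively,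 and $\mathit{Ml}_N,\mathit{Mr}_N$ consist of the columns $|I|\le N$ and of the rows $(j,J)$ whose finite entries in both $\mathit{Ml}$ and $\mathit{Mr}$ lie in these columns. A solution of $M_N\odot(0,\vec y)$ is a vector with coordinates $y_I\in\mathbb{R}_\infty$, with coordinate at $I=\vec0$ (constant monomial) equal to $0$, such that for each row $r$ the minimum $\min_I(m_{r,I}+y_I)$ is attained for at least two different $I$ or equals $\infty$. A solution of $\mathit{Ml}_N\odot(0,\vec y)=\mathit{Mr}_N\odot(0,\vec y)$ is such a vector (coordinate at $\vec0$ equal to $0$) for which in each row $r$ the values $\min_I(\mathit{Ml}_{r,I}+y_I)$ and $\min_I(\mathit{Mr}_{r,I}+y_I)$ are equal. *)

theory Defs
  imports Complex_Main "HOL-Library.Extended_Real"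
begin

text \<open>
  The min-plus semiring is the set of extended reals other than \<open>-\<infinity>\<close>, with \<open>min\<close> as tropical
  addition and \<open>+\<close> as tropical multiplication.  Multiplication of extended reals satisfies
  \<open>0 * \<infinity> = 0\<close>.
\<close>

definition Rinf :: "ereal set" where
  "Rinf = {x. x \<noteq> -\<infinity>}"

text \<open>
  The variables are numbered \<open>0, \<dots>, s - 1\<close>.  An exponent vector is a function on all of \<open>nat\<close> that
  vanishes from \<open>s\<close> on, so that each vector of length \<open>s\<close> has exactly one representative.
\<close>

type_synonym expvec = "nat \<Rightarrow> nat"

definition expvecs :: "nat \<Rightarrow> expvec set" where
  "expvecs s = {I. \<forall>i\<ge>s. I i = 0}"

definition total_deg :: "nat \<Rightarrow> expvec \<Rightarrow> nat" where
  "total_deg s I = (\<Sum>i<s. I i)"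

text \<open>
  A tropical polynomial is given by its coefficients; the value \<open>\<infinity>\<close> means that the monomial is
  absent.
\<close>

type_synonym tpoly = "expvec \<Rightarrow> ereal"

definition monoms :: "tpoly \<Rightarrow> expvec set" where
  "monoms f = {I. f I \<noteq> \<infinity>}"

definition trop_poly :: "nat \<Rightarrow> tpoly \<Rightarrow> bool" where
  "trop_poly s f \<longleftrightarrow> finite (monoms f) \<and> monoms f \<subseteq> expvecs s \<and> range f \<subseteq> Rinf"

text \<open>The polynomial without monomials gets degree \<open>0\<close>.\<close>

definition tdegree :: "nat \<Rightarrow> tpoly \<Rightarrow> nat" where
  "tdegree s f = Max (insert 0 (total_deg s ` monoms f))"

definition monom_val :: "nat \<Rightarrow> tpoly \<Rightarrow> expvec \<Rightarrow> (nat \<Rightarrow> ereal) \<Rightarrow> ereal" where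
  "monom_val s f I a = f I + (\<Sum>i<s. ereal (real (I i)) * a i)"

text \<open>
  The infima below range over finite sets, so they are minima; over the empty set the value is
  \<open>\<infinity>\<close>, the neutral element of tropical addition.
\<close>

definition tpoly_val :: "nat \<Rightarrow> tpoly \<Rightarrow> (nat \<Rightarrow> ereal) \<Rightarrow> ereal" where
  "tpoly_val s f a = (INF I\<in>monoms f. monom_val s f I a)"

definition min_twice_or_inf :: "'a set \<Rightarrow> ('a \<Rightarrow> ereal) \<Rightarrow> bool" where
  "min_twice_or_inf A v \<longleftrightarrow>
     (INF i\<in>A. v i) = \<infinity> \<or>
     (\<exists>i\<in>A. \<exists>j\<in>A. i \<noteq> j \<and> v i = (INF k\<in>A. v k) \<and> v j = (INF k\<in>A. v k))"

definition points :: "nat \<Rightarrow> (nat \<Rightarrow> ereal) set" where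
  "points s = {a. \<forall>i<s. a i \<in> Rinf}"

definition trop_root :: "nat \<Rightarrow> tpoly \<Rightarrow> (nat \<Rightarrow> ereal) \<Rightarrow> bool" where
  "trop_root s f a \<longleftrightarrow> min_twice_or_inf (monoms f) (\<lambda>I. monom_val s f I a)"

definition minplus_root :: "nat \<Rightarrow> tpoly \<times> tpoly \<Rightarrow> (nat \<Rightarrow> ereal) \<Rightarrow> bool" where
  "minplus_root s p a \<longleftrightarrow> tpoly_val s (fst p) a = tpoly_val s (snd p) a"

definition minplus_poly :: "nat \<Rightarrow> tpoly \<times> tpoly \<Rightarrow> bool" where
  "minplus_poly s p \<longleftrightarrow> trop_poly s (fst p) \<and> trop_poly s (snd p)"

definition minplus_degree :: "nat \<Rightarrow> tpoly \<times> tpoly \<Rightarrow> nat" where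
  "minplus_degree s p = max (tdegree s (fst p)) (tdegree s (snd p))"

text \<open>Tropical product of the monomial with exponent \<open>J\<close> and coefficient \<open>0\<close> with \<open>f\<close>.\<close>

definition monom_times :: "expvec \<Rightarrow> tpoly \<Rightarrow> tpoly" where
  "monom_times J f = (\<lambda>I. if J \<le> I then f (\<lambda>i. I i - J i) else \<infinity>)"

definition macaulay :: "tpoly list \<Rightarrow> nat \<times> expvec \<Rightarrow> expvec \<Rightarrow> ereal" where
  "macaulay F r I = monom_times (snd r) (F ! fst r) I"

definition mac_cols :: "nat \<Rightarrow> nat \<Rightarrow> expvec set" where
  "mac_cols s N = {I \<in> expvecs s. total_deg s I \<le> N}"

definition mac_rows :: "nat \<Rightarrow> tpoly list \<Rightarrow> nat \<Rightarrow> (nat \<times> expvec) set" where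
  "mac_rows s F N =
     {r \<in> {..<length F} \<times> expvecs s.
        \<forall>I\<in>expvecs s. macaulay F r I \<noteq> \<infinity> \<longrightarrow> I \<in> mac_cols s N}"

definition nonhom_vector :: "nat \<Rightarrow> nat \<Rightarrow> (expvec \<Rightarrow> ereal) \<Rightarrow> bool" where
  "nonhom_vector s N y \<longleftrightarrow> (\<forall>I\<in>mac_cols s N. y I \<in> Rinf) \<and> y (\<lambda>_. 0) = 0"

definition trop_macaulay_solution :: "nat \<Rightarrow> tpoly list \<Rightarrow> nat \<Rightarrow> (expvec \<Rightarrow> ereal) \<Rightarrow> bool" where
  "trop_macaulay_solution s F N y \<longleftrightarrow>
     nonhom_vector s N y \<and>
     (\<forall>r\<in>mac_rows s F N. min_twice_or_inf (mac_cols s N) (\<lambda>I. macaulay F r I + y I))"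

definition minplus_macaulay_solution ::
  "nat \<Rightarrow> (tpoly \<times> tpoly) list \<Rightarrow> nat \<Rightarrow> (expvec \<Rightarrow> ereal) \<Rightarrow> bool" where
  "minplus_macaulay_solution s F N y \<longleftrightarrow>
     nonhom_vector s N y \<and>
     (\<forall>r\<in>mac_rows s (map fst F) N \<inter> mac_rows s (map snd F) N.
        (INF I\<in>mac_cols s N. macaulay (map fst F) r I + y I) =
        (INF I\<in>mac_cols s N. macaulay (map snd F) r I + y I))"

end

theory Submission
  imports Defs
begin

text \<open>
  Write \<open>x\<^sub>0, \<dots>, x\<^bsub>n-1\<^esub>, z\<close> for the \<open>n + 1\<close> variables.  The system, a tropical version of an example of
  Lazard, Mora and Philippon for the effective Nullstellensatz, is, with all coefficients \<open>0\<close>,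
  the monomial \<open>x\<^sub>0\<^sup>d\<close>, the binomials \<open>x\<^sub>i z\<^bsup>d-1\<^esup> \<oplus> x\<^bsub>i+1\<^esub>\<^sup>d\<close> for \<open>i < n - 1\<close>, and the binomial
  \<open>x\<^bsub>n-1\<^esub> z\<^bsup>d-1\<^esup> \<oplus> 0\<close>.  For the min-plus version the two monomials of each binomial are equated, and \<open>x\<^sub>0\<^sup>d\<close> is equated with \<open>\<infinity>\<close>.

  There is no root: a common root has \<open>x\<^sub>0 = \<infinity>\<close>, and at a root of a binomial both monomials have the
  same value, so \<open>\<infinity>\<close> propagates to \<open>x\<^sub>1\<close>, \<open>x\<^sub>2\<close>, and so on up to \<open>x\<^bsub>n-1\<^esub>\<close>; then the last binomial
  compares \<open>\<infinity>\<close> with \<open>0\<close> (\<open>no_infinite_propagation\<close>).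

  The linear system is nevertheless solvable.  Without \<open>x\<^sub>0\<^sup>d\<close> the system has a curve of roots
  \<open>z = -t\<close>, \<open>x\<^sub>i = (d\<^bsup>n-i\<^esup> - 1) t\<close>, and the monomial \<open>I\<close> takes the value \<open>weight I \<cdot> t\<close> on it.  Let \<open>y\<close> be
  \<open>0\<close> at the monomials of weight \<open>0\<close> and \<open>\<infinity>\<close> at all others.  Both monomials of a binomial have the same
  weight, also after multiplication by a common monomial, so \<open>y\<close> solves the rows of the binomials.
  A row of \<open>x\<^sub>0\<^sup>d\<close> requires \<open>y = \<infinity>\<close> at a multiple of \<open>x\<^sub>0\<^sup>d\<close>.  The weight of \<open>x\<^sub>0\<^sup>d\<close> is \<open>d\<^bsup>n+1\<^esup> - d\<close>, and a
  factor \<open>z\<close>, the cheapest way to lower the weight, lowers it by \<open>1\<close> only, so weight \<open>0\<close> is out of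
  reach in degrees below \<open>d\<^bsup>n+1\<^esup>\<close>, in particular up to \<open>d\<^bsup>n-1\<^esup> - 1\<close>
  (\<open>weight_multiple_first_power\<close>).
\<close>

section \<open>Polynomials with coefficients zero\<close>

definition unit_poly :: "expvec set \<Rightarrow> tpoly" where
  "unit_poly S = (\<lambda>I. if I \<in> S then 0 else \<infinity>)"

lemma monoms_unit_poly [simp]: "monoms (unit_poly S) = S"
  by (auto simp: monoms_def unit_poly_def)

lemma trop_poly_unit_poly:
  "finite S \<Longrightarrow> S \<subseteq> expvecs s \<Longrightarrow> trop_poly s (unit_poly S)"
  by (auto simp: trop_poly_def Rinf_def unit_poly_def monoms_unit_poly[unfolded unit_poly_def])

lemma tdegree_unit_poly: "tdegree s (unit_poly S) = Max (insert 0 (total_deg s ` S))"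
  by (simp add: tdegree_def)

definition monom_sum :: "nat \<Rightarrow> expvec \<Rightarrow> (nat \<Rightarrow> ereal) \<Rightarrow> ereal" where
  "monom_sum s I a = (\<Sum>i<s. ereal (real (I i)) * a i)"

lemma monom_val_unit_poly: "I \<in> S \<Longrightarrow> monom_val s (unit_poly S) I a = monom_sum s I a"
  by (simp add: monom_val_def unit_poly_def monom_sum_def)

lemma tpoly_val_unit_poly: "tpoly_val s (unit_poly S) a = (INF I\<in>S. monom_sum s I a)"
  by (simp add: tpoly_val_def monom_val_unit_poly cong: INF_cong)

lemma trop_root_unit_monomial:
  assumes "trop_root s (unit_poly {I}) a"
  shows "monom_sum s I a = \<infinity>"
  using assms by (auto simp: trop_root_def min_twice_or_inf_def monom_val_unit_poly)

text \<open>If the minimum is \<open>\<infinity>\<close>, both values are \<open>\<infinity>\<close>; if it is attained twice, both are the minimum.\<close>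

lemma trop_root_unit_binomial:
  assumes "trop_root s (unit_poly {I, J}) a"
  shows "monom_sum s I a = monom_sum s J a"
  using assms
  by (auto simp: trop_root_def min_twice_or_inf_def monom_val_unit_poly inf_min min_def split: if_splits)

lemma monom_sum_eq_infty_iff:
  assumes "a \<in> points s"
  shows "monom_sum s I a = \<infinity> \<longleftrightarrow> (\<exists>i<s. I i \<noteq> 0 \<and> a i = \<infinity>)"
proof -
  have "ereal (real (I i)) * a i = \<infinity> \<longleftrightarrow> I i \<noteq> 0 \<and> a i = \<infinity>" if "i < s" for i
    using assms that by (cases "a i") (auto simp: points_def Rinf_def)
  then show ?thesis
    by (auto simp: monom_sum_def sum_Pinfty)
qed

section \<open>Macaulay rows of such polynomials\<close>

definition shift :: "expvec \<Rightarrow> expvec \<Rightarrow> expvec" where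
  "shift J K = (\<lambda>i. J i + K i)"

lemma inj_shift: "shift J K = shift J L \<longleftrightarrow> K = L"
  by (auto simp: shift_def fun_eq_iff)

lemma total_deg_shift: "total_deg s (shift J K) = total_deg s J + total_deg s K"
  by (simp add: total_deg_def shift_def sum.distrib)

lemma macaulay_unit_poly:
  assumes "F ! j = unit_poly S"
  shows "macaulay F (j, J) I = (if I \<in> shift J ` S then 0 else \<infinity>)"
proof -
  have "J \<le> I \<and> (\<lambda>i. I i - J i) \<in> S \<longleftrightarrow> I \<in> shift J ` S"
  proof
    assume "J \<le> I \<and> (\<lambda>i. I i - J i) \<in> S"
    moreover from this have "I = shift J (\<lambda>i. I i - J i)"
      by (auto simp: shift_def le_fun_def)
    ultimately show "I \<in> shift J ` S" by blast
  next
    assume "I \<in> shift J ` S"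
    then show "J \<le> I \<and> (\<lambda>i. I i - J i) \<in> S"
      by (auto simp: shift_def le_fun_def)
  qed
  then show ?thesis
    by (auto simp: macaulay_def monom_times_def assms unit_poly_def)
qed

lemma shift_in_mac_cols:
  assumes "(j, J) \<in> mac_rows s F N" and "F ! j = unit_poly S" and "S \<subseteq> expvecs s" and "K \<in> S"
  shows "shift J K \<in> mac_cols s N"
proof -
  have "shift J K \<in> expvecs s"
    using assms by (auto simp: mac_rows_def expvecs_def shift_def)
  then show ?thesis
    using assms(1,4) by (auto simp: mac_rows_def macaulay_unit_poly[OF assms(2)])
qed

text \<open>
  The row of a shifted polynomial evaluates \<open>y\<close> like the polynomial itself, as if \<open>y (shift J K)\<close> were
  the value of the monomial \<open>K\<close>: as \<open>y\<close> never is \<open>-\<infinity>\<close>, the columns where the row is \<open>\<infinity>\<close> contribute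
  \<open>\<infinity>\<close>.
\<close>

lemma macaulay_row_INF:
  fixes y :: "expvec \<Rightarrow> ereal"
  assumes row: "(j, J) \<in> mac_rows s F N" and F: "F ! j = unit_poly S" and S: "S \<subseteq> expvecs s"
    and y: "\<And>I. y I \<noteq> -\<infinity>"
  shows "(INF I\<in>mac_cols s N. macaulay F (j, J) I + y I) = (INF K\<in>S. y (shift J K))"
proof (rule antisym)
  show "(INF I\<in>mac_cols s N. macaulay F (j, J) I + y I) \<le> (INF K\<in>S. y (shift J K))"
  proof (rule INF_mono)
    fix K assume "K \<in> S"
    then show "\<exists>I\<in>mac_cols s N. macaulay F (j, J) I + y I \<le> y (shift J K)"
      using shift_in_mac_cols[OF row F S] by (auto simp: macaulay_unit_poly[OF F])
  qed
  show "(INF K\<in>S. y (shift J K)) \<le> (INF I\<in>mac_cols s N. macaulay F (j, J) I + y I)"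
  proof (rule INF_greatest)
    fix I
    show "(INF K\<in>S. y (shift J K)) \<le> macaulay F (j, J) I + y I"
      using y[of I] by (auto simp: macaulay_unit_poly[OF F] intro: INF_lower)
  qed
qed

lemma macaulay_row_unit_monomial:
  fixes y :: "expvec \<Rightarrow> ereal"
  assumes "(j, J) \<in> mac_rows s F N" and "F ! j = unit_poly {K}" and "K \<in> expvecs s"
    and "\<And>I. y I \<noteq> -\<infinity>" and "y (shift J K) = \<infinity>"
  shows "min_twice_or_inf (mac_cols s N) (\<lambda>I. macaulay F (j, J) I + y I)"
  using macaulay_row_INF[of j J s F N "{K}" y] assms by (simp add: min_twice_or_inf_def)

lemma macaulay_row_unit_binomial:
  fixes y :: "expvec \<Rightarrow> ereal"
  assumes row: "(j, J) \<in> mac_rows s F N" and F: "F ! j = unit_poly {K, L}"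
    and KL: "{K, L} \<subseteq> expvecs s" "K \<noteq> L"
    and y: "\<And>I. y I \<noteq> -\<infinity>" and eq: "y (shift J K) = y (shift J L)"
  shows "min_twice_or_inf (mac_cols s N) (\<lambda>I. macaulay F (j, J) I + y I)"
proof -
  have inf: "(INF I\<in>mac_cols s N. macaulay F (j, J) I + y I) = y (shift J L)"
    using macaulay_row_INF[OF row F KL(1) y] eq by simp
  show ?thesis
    unfolding min_twice_or_inf_def inf
    using shift_in_mac_cols[OF row F KL(1)] KL(2) eq
    by (intro disjI2 bexI[of _ "shift J K"] bexI[of _ "shift J L"])
       (auto simp: inj_shift macaulay_unit_poly[OF F])
qed

section \<open>The monomials of the system\<close>

text \<open>Variable \<open>n\<close> is \<open>z\<close>.\<close>

definition power_vec :: "nat \<Rightarrow> nat \<Rightarrow> expvec" where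
  "power_vec i k = (\<lambda>j. if j = i then k else 0)"

definition left_monom :: "nat \<Rightarrow> nat \<Rightarrow> nat \<Rightarrow> expvec" where
  "left_monom n d i = shift (power_vec i 1) (power_vec n (d - 1))"

text \<open>The last binomial has the constant monomial on its right-hand side.\<close>

definition right_monom :: "nat \<Rightarrow> nat \<Rightarrow> nat \<Rightarrow> expvec" where
  "right_monom n d i = power_vec (Suc i) (if Suc i < n then d else 0)"

lemma power_vec_in_expvecs: "i < s \<Longrightarrow> power_vec i k \<in> expvecs s"
  by (auto simp: power_vec_def expvecs_def)

lemma left_monom_in_expvecs: "i < n \<Longrightarrow> left_monom n d i \<in> expvecs (n + 1)"
  by (auto simp: left_monom_def shift_def power_vec_def expvecs_def)

lemma right_monom_in_expvecs: "i < n \<Longrightarrow> right_monom n d i \<in> expvecs (n + 1)"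
  by (simp add: right_monom_def power_vec_in_expvecs)

lemma left_monom_neq_right_monom: "i < n \<Longrightarrow> left_monom n d i \<noteq> right_monom n d i"
  by (auto simp: left_monom_def right_monom_def shift_def power_vec_def fun_eq_iff intro: exI[of _ i])

lemma total_deg_power_vec: "i < s \<Longrightarrow> total_deg s (power_vec i k) = k"
  by (simp add: total_deg_def power_vec_def)

lemma total_deg_left_monom: "i < n \<Longrightarrow> d \<ge> 1 \<Longrightarrow> total_deg (n + 1) (left_monom n d i) = d"
  by (simp add: left_monom_def total_deg_shift total_deg_power_vec)

lemma total_deg_right_monom: "i < n \<Longrightarrow> total_deg (n + 1) (right_monom n d i) \<le> d"
  by (simp add: right_monom_def total_deg_power_vec)

text \<open>
  The hypotheses hold at a common root of either system.  An infinite \<open>x\<^sub>i\<close> makes the left monomial of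
  binomial \<open>i\<close> infinite, whatever \<open>z\<close> is; the right one is then infinite too, which passes \<open>\<infinity>\<close> on to
  \<open>x\<^bsub>i+1\<^esub>\<close> and is impossible for the constant monomial.
\<close>

lemma no_infinite_propagation:
  assumes a: "a \<in> points (n + 1)" and "n \<ge> 1"
    and first: "monom_sum (n + 1) (power_vec 0 d) a = \<infinity>"
    and eq: "\<And>i. i < n \<Longrightarrow> monom_sum (n + 1) (left_monom n d i) a = monom_sum (n + 1) (right_monom n d i) a"
  shows False
proof -
  note infty_iff = monom_sum_eq_infty_iff[OF a]
  have right: "\<exists>j<n + 1. right_monom n d i j \<noteq> 0 \<and> a j = \<infinity>" if "i < n" "a i = \<infinity>" for i
  proof -
    have "monom_sum (n + 1) (left_monom n d i) a = \<infinity>"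
      unfolding infty_iff using that
      by (intro exI[of _ i]) (auto simp: left_monom_def shift_def power_vec_def)
    then show ?thesis
      using eq[OF that(1)] by (simp only: infty_iff)
  qed
  have "a i = \<infinity>" if "i < n" for i
    using that
  proof (induction i)
    case 0
    then show ?case
      using first unfolding infty_iff by (auto simp: power_vec_def split: if_splits)
  next
    case (Suc i)
    then show ?case
      using right[of i] by (auto simp: right_monom_def power_vec_def split: if_splits)
  qed
  then show False
    using right[of "n - 1"] \<open>n \<ge> 1\<close> by (auto simp: right_monom_def power_vec_def split: if_splits)
qed

section \<open>Weights and the solution of the linear system\<close>

definition var_weight :: "nat \<Rightarrow> nat \<Rightarrow> nat \<Rightarrow> int" where
  "var_weight n d i = (if i < n then int d ^ (n - i) - 1 else -1)"

definition weight :: "nat \<Rightarrow> nat \<Rightarrow> expvec \<Rightarrow> int" where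
  "weight n d I = (\<Sum>i<n + 1. var_weight n d i * int (I i))"

definition weight_solution :: "nat \<Rightarrow> nat \<Rightarrow> expvec \<Rightarrow> ereal" where
  "weight_solution n d I = (if weight n d I = 0 then 0 else \<infinity>)"

lemma weight_shift: "weight n d (shift J K) = weight n d J + weight n d K"
  by (simp add: weight_def shift_def sum.distrib algebra_simps)

lemma weight_power_vec: "i < n + 1 \<Longrightarrow> weight n d (power_vec i k) = var_weight n d i * int k"
proof -
  assume "i < n + 1"
  have "weight n d (power_vec i k) = (\<Sum>j<n + 1. if j = i then var_weight n d i * int k else 0)"
    unfolding weight_def by (rule sum.cong) (auto simp: power_vec_def)
  also have "\<dots> = var_weight n d i * int k"
    using \<open>i < n + 1\<close> by (simp add: sum.delta del: sum.lessThan_Suc)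
  finally show ?thesis .
qed

text \<open>
  With weight \<open>-1\<close> for \<open>z\<close>, these equations force the weights of the \<open>x\<^sub>i\<close>, from the last binomial
  backwards.  Both sides have weight \<open>d\<^bsup>n-i\<^esup> - d\<close>, which is \<open>0\<close> for the constant monomial at \<open>i = n - 1\<close>.
\<close>

lemma weight_left_eq_right:
  assumes "i < n" and "d \<ge> 1"
  shows "weight n d (left_monom n d i) = weight n d (right_monom n d i)"
proof -
  have "weight n d (left_monom n d i) = int d ^ (n - i) - int d"
    using assms by (simp add: left_monom_def weight_shift weight_power_vec var_weight_def of_nat_diff)
  moreover have "weight n d (right_monom n d i) = int d ^ (n - i) - int d"
  proof (cases "Suc i < n")
    case True
    have "n - i = Suc (n - Suc i)" using assms by simp
    then have "int d ^ (n - i) = int d ^ (n - Suc i) * int d" by simp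
    with True show ?thesis
      by (simp add: right_monom_def weight_power_vec var_weight_def algebra_simps)
  next
    case False
    then have "n - i = 1" using assms by simp
    with False assms show ?thesis
      by (simp add: right_monom_def weight_power_vec)
  qed
  ultimately show ?thesis by simp
qed

lemma weight_ge_neg_total_deg: "weight n d I \<ge> - int (total_deg (n + 1) I)"
proof -
  have "(\<Sum>i<n + 1. - int (I i)) \<le> weight n d I"
    unfolding weight_def
  proof (rule sum_mono)
    fix i
    have "-1 < int d ^ (n - i)" by (rule less_le_trans[of _ 0]) simp_all
    then have "-1 \<le> var_weight n d i"
      by (simp add: var_weight_def)
    then have "-1 * int (I i) \<le> var_weight n d i * int (I i)"
      by (rule mult_right_mono) simp
    then show "- int (I i) \<le> var_weight n d i * int (I i)" by simp
  qed
  then show ?thesis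
    by (simp add: total_deg_def sum_negf)
qed

lemma weight_multiple_first_power:
  assumes "n \<ge> 1" and deg: "total_deg (n + 1) (shift J (power_vec 0 d)) < d ^ (n + 1)"
  shows "weight n d (shift J (power_vec 0 d)) > 0"
proof -
  have "int (total_deg (n + 1) J) + int d < int (d ^ (n + 1))"
    using deg by (simp only: total_deg_shift total_deg_power_vec of_nat_add[symmetric] of_nat_less_iff
        add_gr_0 zero_less_one simp_thms)
  moreover have "weight n d (shift J (power_vec 0 d)) = weight n d J + (int d ^ (n + 1) - int d)"
    using assms by (simp add: weight_shift weight_power_vec var_weight_def algebra_simps)
  moreover have "weight n d J \<ge> - int (total_deg (n + 1) J)"
    by (rule weight_ge_neg_total_deg)
  ultimately show ?thesis
    by simp
qed

lemma weight_solution_first_power: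
  assumes "n \<ge> 1" and "shift J (power_vec 0 d) \<in> mac_cols (n + 1) N" and "N < d ^ (n + 1)"
  shows "weight_solution n d (shift J (power_vec 0 d)) = \<infinity>"
  using weight_multiple_first_power[of n J d] assms by (auto simp: mac_cols_def weight_solution_def)

lemma weight_solution_left_eq_right:
  assumes "i < n" and "d \<ge> 1"
  shows "weight_solution n d (shift J (left_monom n d i)) = weight_solution n d (shift J (right_monom n d i))"
  using weight_left_eq_right[OF assms] by (simp add: weight_solution_def weight_shift)

lemma weight_solution_not_minus_infty: "weight_solution n d I \<noteq> -\<infinity>"
  by (simp add: weight_solution_def)

lemma nonhom_vector_weight_solution: "nonhom_vector s N (weight_solution n d)"
  by (simp add: nonhom_vector_def Rinf_def weight_solution_def weight_def)

section \<open>The two systems\<close>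

definition trop_system :: "nat \<Rightarrow> nat \<Rightarrow> tpoly list" where
  "trop_system n d = unit_poly {power_vec 0 d} #
     map (\<lambda>i. unit_poly {left_monom n d i, right_monom n d i}) [0..<n]"

definition minplus_system :: "nat \<Rightarrow> nat \<Rightarrow> (tpoly \<times> tpoly) list" where
  "minplus_system n d = (unit_poly {power_vec 0 d}, unit_poly {}) #
     map (\<lambda>i. (unit_poly {left_monom n d i}, unit_poly {right_monom n d i})) [0..<n]"

lemma trop_system_macaulay:
  assumes n: "n \<ge> 1" and d: "d \<ge> 1" and N: "N < d ^ (n + 1)"
  shows "trop_macaulay_solution (n + 1) (trop_system n d) N (weight_solution n d)"
  unfolding trop_macaulay_solution_def
proof (intro conjI ballI nonhom_vector_weight_solution)
  fix r assume r: "r \<in> mac_rows (n + 1) (trop_system n d) N"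
  obtain j J where jJ: "r = (j, J)" by (cases r)
  note row = r[unfolded jJ]
  have "j < n + 1"
    using row by (simp add: mac_rows_def trop_system_def)
  show "min_twice_or_inf (mac_cols (n + 1) N)
          (\<lambda>I. macaulay (trop_system n d) r I + weight_solution n d I)"
  proof (cases j)
    case 0
    then have F: "trop_system n d ! j = unit_poly {power_vec 0 d}"
      by (simp add: trop_system_def)
    have K: "power_vec 0 d \<in> expvecs (n + 1)"
      by (simp add: power_vec_in_expvecs)
    have "shift J (power_vec 0 d) \<in> mac_cols (n + 1) N"
      using shift_in_mac_cols[OF row F] K by simp
    then show ?thesis
      unfolding jJ
      by (intro macaulay_row_unit_monomial[OF row F K] weight_solution_not_minus_infty
          weight_solution_first_power[OF n _ N])
  next
    case (Suc i)
    with \<open>j < n + 1\<close> have i: "i < n" by simp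
    then have F: "trop_system n d ! j = unit_poly {left_monom n d i, right_monom n d i}"
      by (simp add: trop_system_def Suc)
    show ?thesis
      unfolding jJ
      using left_monom_in_expvecs[OF i] right_monom_in_expvecs[OF i]
      by (intro macaulay_row_unit_binomial[OF row F] weight_solution_not_minus_infty
          weight_solution_left_eq_right i d left_monom_neq_right_monom) simp
  qed
qed

lemma minplus_system_macaulay:
  assumes n: "n \<ge> 1" and d: "d \<ge> 1" and N: "N < d ^ (n + 1)"
  shows "minplus_macaulay_solution (n + 1) (minplus_system n d) N (weight_solution n d)"
  unfolding minplus_macaulay_solution_def
proof (intro conjI ballI nonhom_vector_weight_solution)
  let ?Fl = "map fst (minplus_system n d)" and ?Fr = "map snd (minplus_system n d)"
  fix r assume r: "r \<in> mac_rows (n + 1) ?Fl N \<inter> mac_rows (n + 1) ?Fr N"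
  obtain j J where jJ: "r = (j, J)" by (cases r)
  from r have rowl: "(j, J) \<in> mac_rows (n + 1) ?Fl N" and rowr: "(j, J) \<in> mac_rows (n + 1) ?Fr N"
    by (auto simp: jJ)
  note INFl = macaulay_row_INF[OF rowl _ _ weight_solution_not_minus_infty]
  note INFr = macaulay_row_INF[OF rowr _ _ weight_solution_not_minus_infty]
  have "j < n + 1"
    using rowl by (simp add: mac_rows_def minplus_system_def)
  show "(INF I\<in>mac_cols (n + 1) N. macaulay ?Fl r I + weight_solution n d I) =
        (INF I\<in>mac_cols (n + 1) N. macaulay ?Fr r I + weight_solution n d I)"
  proof (cases j)
    case 0
    then have Fl: "?Fl ! j = unit_poly {power_vec 0 d}" and Fr: "?Fr ! j = unit_poly {}"
      by (simp_all add: minplus_system_def)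
    have K: "{power_vec 0 d} \<subseteq> expvecs (n + 1)"
      by (simp add: power_vec_in_expvecs)
    have "shift J (power_vec 0 d) \<in> mac_cols (n + 1) N"
      using shift_in_mac_cols[OF rowl Fl K] by simp
    then have "weight_solution n d (shift J (power_vec 0 d)) = \<infinity>"
      by (rule weight_solution_first_power[OF n _ N])
    then show ?thesis
      unfolding jJ INFl[OF Fl K] INFr[OF Fr empty_subsetI] by (simp add: top_ereal_def)
  next
    case (Suc i)
    with \<open>j < n + 1\<close> have i: "i < n" by simp
    then have Fl: "?Fl ! j = unit_poly {left_monom n d i}"
      and Fr: "?Fr ! j = unit_poly {right_monom n d i}"
      by (simp_all add: minplus_system_def Suc)
    have Kl: "{left_monom n d i} \<subseteq> expvecs (n + 1)" and Kr: "{right_monom n d i} \<subseteq> expvecs (n + 1)"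
      using left_monom_in_expvecs[OF i] right_monom_in_expvecs[OF i] by simp_all
    show ?thesis
      unfolding jJ INFl[OF Fl Kl] INFr[OF Fr Kr]
      using weight_solution_left_eq_right[OF i d] by simp
  qed
qed

lemma trop_system_no_root:
  assumes "n \<ge> 1"
  shows "\<not> (\<exists>a\<in>points (n + 1). \<forall>f\<in>set (trop_system n d). trop_root (n + 1) f a)"
proof
  assume "\<exists>a\<in>points (n + 1). \<forall>f\<in>set (trop_system n d). trop_root (n + 1) f a"
  then obtain a where a: "a \<in> points (n + 1)"
    and root: "\<And>f. f \<in> set (trop_system n d) \<Longrightarrow> trop_root (n + 1) f a" by blast
  show False
  proof (rule no_infinite_propagation[OF a assms])
    show "monom_sum (n + 1) (power_vec 0 d) a = \<infinity>"
      by (intro trop_root_unit_monomial root) (simp add: trop_system_def)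
    show "monom_sum (n + 1) (left_monom n d i) a = monom_sum (n + 1) (right_monom n d i) a" if "i < n" for i
      using that by (intro trop_root_unit_binomial root) (auto simp: trop_system_def)
  qed
qed

lemma minplus_system_no_root:
  assumes "n \<ge> 1"
  shows "\<not> (\<exists>a\<in>points (n + 1). \<forall>p\<in>set (minplus_system n d). minplus_root (n + 1) p a)"
proof
  assume "\<exists>a\<in>points (n + 1). \<forall>p\<in>set (minplus_system n d). minplus_root (n + 1) p a"
  then obtain a where a: "a \<in> points (n + 1)"
    and root: "\<And>p. p \<in> set (minplus_system n d) \<Longrightarrow> minplus_root (n + 1) p a" by blast
  show False
  proof (rule no_infinite_propagation[OF a assms])
    show "monom_sum (n + 1) (power_vec 0 d) a = \<infinity>"
      using root[of "(unit_poly {power_vec 0 d}, unit_poly {})"]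
      by (simp add: minplus_system_def minplus_root_def tpoly_val_unit_poly top_ereal_def)
    show "monom_sum (n + 1) (left_monom n d i) a = monom_sum (n + 1) (right_monom n d i) a" if "i < n" for i
      using root[of "(unit_poly {left_monom n d i}, unit_poly {right_monom n d i})"] that
      by (simp add: minplus_system_def minplus_root_def tpoly_val_unit_poly)
  qed
qed

lemma trop_system_degree:
  assumes "d \<ge> 1"
  shows "Max (tdegree (n + 1) ` set (trop_system n d)) = d"
proof -
  have "tdegree (n + 1) f = d" if "f \<in> set (trop_system n d)" for f
    using that assms total_deg_left_monom[of _ n d] total_deg_right_monom[of _ n d]
    by (auto simp: trop_system_def tdegree_unit_poly total_deg_power_vec max_def intro!: antisym)
  then have "tdegree (n + 1) ` set (trop_system n d) = {d}"
    by (auto simp: trop_system_def)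
  then show ?thesis by simp
qed

lemma minplus_system_degree:
  assumes "d \<ge> 1"
  shows "Max (minplus_degree (n + 1) ` set (minplus_system n d)) = d"
proof -
  have "minplus_degree (n + 1) p = d" if "p \<in> set (minplus_system n d)" for p
    using that assms total_deg_left_monom[of _ n d] total_deg_right_monom[of _ n d]
    by (auto simp: minplus_system_def minplus_degree_def tdegree_unit_poly total_deg_power_vec max_def intro!: antisym)
  then have "minplus_degree (n + 1) ` set (minplus_system n d) = {d}"
    by (auto simp: minplus_system_def)
  then show ?thesis by simp
qed

lemma trop_system_polys: "f \<in> set (trop_system n d) \<Longrightarrow> trop_poly (n + 1) f"
  using left_monom_in_expvecs[of _ n d] right_monom_in_expvecs[of _ n d]
  by (auto simp: trop_system_def power_vec_in_expvecs intro!: trop_poly_unit_poly)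

lemma minplus_system_polys: "p \<in> set (minplus_system n d) \<Longrightarrow> minplus_poly (n + 1) p"
  using left_monom_in_expvecs[of _ n d] right_monom_in_expvecs[of _ n d]
  by (auto simp: minplus_system_def minplus_poly_def power_vec_in_expvecs intro!: trop_poly_unit_poly)

theorem mainTheorem15:
  fixes n d :: nat
  assumes "n \<ge> 1" and "d > 1"
  shows "(\<exists>F :: tpoly list.
            length F = n + 1 \<and>
            (\<forall>f\<in>set F. trop_poly (n + 1) f) \<and>
            Max (tdegree (n + 1) ` set F) = d \<and>
            \<not> (\<exists>a\<in>points (n + 1). \<forall>f\<in>set F. trop_root (n + 1) f a) \<and>
            (\<exists>y. trop_macaulay_solution (n + 1) F (d ^ (n - 1) - 1) y)) \<and>
         (\<exists>F :: (tpoly \<times> tpoly) list.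
            length F = n + 1 \<and>
            (\<forall>p\<in>set F. minplus_poly (n + 1) p) \<and>
            Max (minplus_degree (n + 1) ` set F) = d \<and>
            \<not> (\<exists>a\<in>points (n + 1). \<forall>p\<in>set F. minplus_root (n + 1) p a) \<and>
            (\<exists>y. minplus_macaulay_solution (n + 1) F (d ^ (n - 1) - 1) y))"
proof (intro conjI)
  have d: "d \<ge> 1" using \<open>d > 1\<close> by simp
  have "d ^ (n - 1) \<le> d ^ (n + 1)"
    using d by (intro power_increasing) auto
  moreover have "0 < d ^ (n - 1)"
    using d by simp
  ultimately have N: "d ^ (n - 1) - 1 < d ^ (n + 1)"
    by linarith
  show "\<exists>F :: tpoly list.
      length F = n + 1 \<and>
      (\<forall>f\<in>set F. trop_poly (n + 1) f) \<and>
      Max (tdegree (n + 1) ` set F) = d \<and>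
      \<not> (\<exists>a\<in>points (n + 1). \<forall>f\<in>set F. trop_root (n + 1) f a) \<and>
      (\<exists>y. trop_macaulay_solution (n + 1) F (d ^ (n - 1) - 1) y)"
  proof (intro exI[of _ "trop_system n d"] conjI ballI)
    show "length (trop_system n d) = n + 1"
      by (simp add: trop_system_def)
    show "\<exists>y. trop_macaulay_solution (n + 1) (trop_system n d) (d ^ (n - 1) - 1) y"
      using trop_system_macaulay[OF \<open>n \<ge> 1\<close> d N] by blast
  qed (fact trop_system_polys trop_system_degree[OF d] trop_system_no_root[OF \<open>n \<ge> 1\<close>])+
  show "\<exists>F :: (tpoly \<times> tpoly) list.
      length F = n + 1 \<and>
      (\<forall>p\<in>set F. minplus_poly (n + 1) p) \<and>
      Max (minplus_degree (n + 1) ` set F) = d \<and>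
      \<not> (\<exists>a\<in>points (n + 1). \<forall>p\<in>set F. minplus_root (n + 1) p a) \<and>
      (\<exists>y. minplus_macaulay_solution (n + 1) F (d ^ (n - 1) - 1) y)"
  proof (intro exI[of _ "minplus_system n d"] conjI ballI)
    show "length (minplus_system n d) = n + 1"
      by (simp add: minplus_system_def)
    show "\<exists>y. minplus_macaulay_solution (n + 1) (minplus_system n d) (d ^ (n - 1) - 1) y"
      using minplus_system_macaulay[OF \<open>n \<ge> 1\<close> d N] by blast
  qed (fact minplus_system_polys minplus_system_degree[OF d] minplus_system_no_root[OF \<open>n \<ge> 1\<close>])+
qed

end
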